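(* Let $H$ be a graph with at least one edge. There exists $\eta_H<1$ such that for all $\eta\in(\eta_H,1)$ there exists a constant $C_{\eta,H}$ such that the following holds. Let $q=\eta^{1/e(H)}$, let $\epsilon>0$ be sufficiently small in terms of $\eta$ and $H$, and let $n\ge v(H)$. Then the constant vector $\mathbf q\equiv q$ is the unique minimizer of the variational problem $\Phi(H,\eta)$, and if $\mathbf q\in[0,1]^{\binom n2}$ satisfies $\mathbb E[N_H(\mathbf q)]\le \eta\, N_H(1)$ and $$\sum_{e} h(q_e)<\Phi(H,\eta)+\epsilon^{12}\binom n2,$$ then $\|\mathbf q-q\|_\square<C_{\eta,H}\,\epsilon$.
   Context: Graphs are finite and simple; $v(H),e(H)$ are the numbers of vertices and edges of $H$. Vectors $\mathbf q=(q_e)\in[0,1]^{\binom n2}$ are indexed by the edges $e$ of the complete graph $K_n$ on $[n]$. $G(n,\mathbf q)$ is the random graph on $[n]$ in which each edge $e$ is included independently with probability $q_e$, and $N_H(\mathbf q)$ is the random number of copies of $H$ (subgraphs isomorphic to $H$) in $G(n,\mathbf q)$; thus $\mathbb E[N_H(\mathbf q)]$ is the sum over all copies of $H$ in $K_n$ of the product of $q_e$ over the edges $e$ of the copy. $N_H(1)$ is the number of copies of $H$ in $K_n$. $h(x)=x\log x-x+1$ for $x\in[0,1]$ (with $h(0)=1$). The variational problem (sparse limit) is $$\Phi(H,\eta)=\min_{\mathbf q\in[0,1]^{\binom n2}}\Big\{\sum_e h(q_e):\ \mathbb E[N_H(\mathbf q)]\le\eta\, N_H(1)\Big\},$$ which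 depends on $n$. Cut norm: for $A\in\mathbb R^{n\times n}$, $\|A\|_\square=\sup_{x,y\in[0,1]^n}\frac1{n^2}|x^\top A y|$. For a real vector $\mathbf v$ indexed by $\binom{[n]}2$, $\|\mathbf v\|_\square$ is the cut norm of the symmetric matrix with zero diagonal and $(i,j)$ entry $v_{\{i,j\}}$, $i\ne j$. In $\mathbf q-q$ the scalar $q$ is identified with the constant vector. The constant $C_{\eta,H}$ and the smallness threshold for $\epsilon$ depend only on $\eta$ and $H$ (not on $n$). *)

theory Defs
  imports "HOL-Probability.Probability" "HOL-Library.Ramsey"
begin

text \<open>A graph is a pair of a vertex set and a set of two-element subsets of it.\<close>

type_synonym 'a graph = "'a set \<times> 'a set set"

definition simple_graph :: "'a graph \<Rightarrow> bool" where
  "simple_graph G \<longleftrightarrow> finite (fst G) \<and> snd G \<subseteq> nsets (fst G) 2"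

definition num_verts :: "'a graph \<Rightarrow> nat" where
  "num_verts G = card (fst G)"

definition num_edges :: "'a graph \<Rightarrow> nat" where
  "num_edges G = card (snd G)"

definition subgraph_of :: "'a graph \<Rightarrow> 'a graph \<Rightarrow> bool" where
  "subgraph_of F G \<longleftrightarrow> simple_graph F \<and> fst F \<subseteq> fst G \<and> snd F \<subseteq> snd G"

definition graph_isomorphic :: "'a graph \<Rightarrow> 'b graph \<Rightarrow> bool" where
  "graph_isomorphic G G' \<longleftrightarrow>
     (\<exists>f. bij_betw f (fst G) (fst G') \<and> (\<lambda>e. f ` e) ` snd G = snd G')"

text \<open>Copies are subgraphs, not embeddings; isolated vertices of \<open>H\<close> belong to the copy.\<close>

definition num_copies :: "'a graph \<Rightarrow> 'b graph \<Rightarrow> nat" where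
  "num_copies H G = card {F. subgraph_of F G \<and> graph_isomorphic H F}"

definition pairs :: "nat \<Rightarrow> nat set set" where
  "pairs n = nsets {1..n} 2"

definition complete_simple_graph :: "nat \<Rightarrow> nat graph" where
  "complete_simple_graph n = ({1..n}, pairs n)"

text \<open>
  Elements of the cube are \<open>undefined\<close> outside \<open>pairs n\<close>, so that equality of functions is
  equality of the vectors indexed by \<open>pairs n\<close>.
\<close>

definition edge_cube :: "nat \<Rightarrow> (nat set \<Rightarrow> real) set" where
  "edge_cube n = pairs n \<rightarrow>\<^sub>E {0..1}"

definition const_vec :: "nat \<Rightarrow> real \<Rightarrow> nat set \<Rightarrow> real" where
  "const_vec n c = (\<lambda>e\<in>pairs n. c)"

definition random_graph :: "nat \<Rightarrow> (nat set \<Rightarrow> real) \<Rightarrow> nat graph pmf" where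
  "random_graph n q =
     map_pmf (\<lambda>b. ({1..n}, {e \<in> pairs n. b e}))
       (Pi_pmf (pairs n) False (\<lambda>e. bernoulli_pmf (q e)))"

definition expected_copies :: "'a graph \<Rightarrow> nat \<Rightarrow> (nat set \<Rightarrow> real) \<Rightarrow> real" where
  "expected_copies H n q =
     measure_pmf.expectation (random_graph n q) (\<lambda>G. real (num_copies H G))"

text \<open>Since \<open>ln 0 = 0\<close>, this gives \<open>h_fun 0 = 1\<close>.\<close>

definition h_fun :: "real \<Rightarrow> real" where
  "h_fun x = x * ln x - x + 1"

definition cost :: "nat \<Rightarrow> (nat set \<Rightarrow> real) \<Rightarrow> real" where
  "cost n q = (\<Sum>e\<in>pairs n. h_fun (q e))"

definition feasible :: "'a graph \<Rightarrow> real \<Rightarrow> nat \<Rightarrow> (nat set \<Rightarrow> real) \<Rightarrow> bool" where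
  "feasible H \<eta> n q \<longleftrightarrow>
     q \<in> edge_cube n \<and> expected_copies H n q \<le> \<eta> * real (num_copies H (complete_simple_graph n))"

text \<open>
  The minimum is attained whenever the feasible set is nonempty (in particular for
  \<open>\<eta> \<ge> 0\<close> if \<open>H\<close> has an edge): the feasible set is compact and the cost is continuous.
\<close>

definition Phi :: "'a graph \<Rightarrow> real \<Rightarrow> nat \<Rightarrow> real" where
  "Phi H \<eta> n = Inf (cost n ` {q. feasible H \<eta> n q})"

definition unique_minimizer :: "'a graph \<Rightarrow> real \<Rightarrow> nat \<Rightarrow> (nat set \<Rightarrow> real) \<Rightarrow> bool" where
  "unique_minimizer H \<eta> n q \<longleftrightarrow>
     (\<forall>q'. is_arg_min (cost n) (feasible H \<eta> n) q' \<longleftrightarrow> q' = q)"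

text \<open>Only the entries with indices in \<open>{1..n}\<close> matter.\<close>

definition cut_norm :: "nat \<Rightarrow> (nat \<Rightarrow> nat \<Rightarrow> real) \<Rightarrow> real" where
  "cut_norm n A =
     (SUP (x, y) \<in> ({1..n} \<rightarrow>\<^sub>E {0..1}) \<times> ({1..n} \<rightarrow>\<^sub>E {0..1}).
        1 / real n ^ 2 * \<bar>\<Sum>i\<in>{1..n}. \<Sum>j\<in>{1..n}. x i * A i j * y j\<bar>)"

definition sym_matrix :: "(nat set \<Rightarrow> real) \<Rightarrow> nat \<Rightarrow> nat \<Rightarrow> real" where
  "sym_matrix v = (\<lambda>i j. if i = j then 0 else v {i, j})"

definition cut_norm_vec :: "nat \<Rightarrow> (nat set \<Rightarrow> real) \<Rightarrow> real" where
  "cut_norm_vec n v = cut_norm n (sym_matrix v)"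

end

theory Submission
  imports Defs
begin

text \<open>
  In the coordinate \<open>u = ln x\<close> the cost \<open>h\<close> is strongly convex on \<open>[1/2, 1]\<close>, and the constraint is
  nearly linear: \<open>exp s \<ge> 1 + s\<close> gives
  \<open>(\<Prod>e. q\<^sub>e) \<ge> \<eta> * (1 + (\<Sum>e. ln q\<^sub>e - ln q))\<close> for each copy, and since all edges of \<open>K\<^sub>n\<close> lie in
  equally many copies, summing over copies yields \<open>(\<Sum>e. ln q\<^sub>e - ln q) \<le> 0\<close> over all edges. The
  tangent line of \<open>h\<close> at \<open>ln q\<close> has negative slope, so its sum is nonnegative on feasible vectors,
  and strong convexity leaves \<open>cost \<ge> cost(q) + (\<Sum>e. (q\<^sub>e - q)\<^sup>2) / 20\<close>. Entries below \<open>1/2\<close> do not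
  fit this picture, but for \<open>\<eta> \<ge> 19/20\<close> each of them costs more than it can gain. This gives both
  uniqueness and a stability bound in \<open>L\<^sup>2\<close>, hence in cut norm of order \<open>\<epsilon>^6\<close>.
\<close>

section \<open>The pointwise inequality\<close>

text \<open>
  The value \<open>- (1 / \<eta>)\<close> makes \<open>\<eta> * (1 + \<dots>)\<close> nonpositive, hence a trivial lower bound for the
  product, as soon as a copy contains an entry below \<open>1/2\<close>.
\<close>

definition log_gain :: "real \<Rightarrow> real \<Rightarrow> real \<Rightarrow> real" where
  "log_gain \<eta> q x = (if x < 1/2 then - (1 / \<eta>) else ln x - ln q)"

text \<open>Since \<open>h_fun\<close> has derivative \<open>ln x\<close>, its slope in the
  coordinate \<open>ln x\<close> at \<open>ln q\<close> is \<open>q * ln q\<close>, so this is a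
  tangent bound with a quadratic remainder. The difference of the two sides vanishes at
  \<open>x = q\<close>, decreases before \<open>q\<close> and increases after it.\<close>

lemma h_fun_lower_half:
  fixes x q :: real
  assumes q: "1/2 \<le> q" "q \<le> 1" and x: "1/2 \<le> x" "x \<le> 1"
  shows "h_fun q + q * ln q * (ln x - ln q) + (x - q)\<^sup>2 / 20 \<le> h_fun x"
proof -
  define F where "F = (\<lambda>t. h_fun t - q * ln q * ln t - (t - q)\<^sup>2 / 20)"
  define m where "m = (\<lambda>t::real. t * ln t - t / 10)"
  have m_mono: "m a \<le> m b" if "1/2 \<le> a" "a \<le> b" for a b
  proof (rule DERIV_nonneg_imp_nondecreasing[OF that(2)])
    fix t assume t: "a \<le> t" "t \<le> b"
    have "t > 0" using t that by simp
    \<comment> \<open>The cutoff 1/2 enters here: 1 - 1/10 - 25/36 is still positive.\<close>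
    have "ln (1/2) \<le> ln t" using t that by simp
    moreover have "ln (1/2::real) \<ge> - (25/36)"
      using ln2_le_25_over_36 by (simp add: ln_div)
    ultimately have "0 \<le> ln t + 1 - 1/10" by simp
    moreover have "(m has_real_derivative ln t + 1 - 1/10) (at t)"
      unfolding m_def using \<open>t > 0\<close> by (auto intro!: derivative_eq_intros)
    ultimately show "\<exists>y. (m has_real_derivative y) (at t) \<and> 0 \<le> y" by blast
  qed
  \<comment> \<open>The derivative of \<open>F\<close>, split so that both summands have the sign of
    \<open>t - q\<close>: the first because \<open>m\<close> is increasing, the second because
    \<open>t \<le> 1\<close>.\<close>
  define F' where "F' = (\<lambda>t. (m t - m q) / t + (t - q) * (1 / t - 1) / 10)"
  have F_deriv: "(F has_real_derivative F' t) (at t)" if "t > 0" for t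
    unfolding F_def F'_def m_def h_fun_def using that
    by (auto intro!: derivative_eq_intros simp: field_simps)
  have "F q \<le> F x"
  proof (cases "q \<le> x")
    case True
    have "\<exists>y. (F has_real_derivative y) (at t) \<and> 0 \<le> y" if "q \<le> t" "t \<le> x" for t
    proof -
      have "0 \<le> F' t" unfolding F'_def
        using m_mono[of q t] that q x by (auto intro!: add_nonneg_nonneg)
      then show ?thesis using F_deriv[of t] that q by auto
    qed
    then show ?thesis by (rule DERIV_nonneg_imp_nondecreasing[OF True])
  next
    case False
    have "\<exists>y. (F has_real_derivative y) (at t) \<and> y \<le> 0" if "x \<le> t" "t \<le> q" for t
    proof -
      have "(m t - m q) / t \<le> 0"
        using m_mono[of t q] that x by (simp add: divide_nonpos_pos)
      moreover have "(t - q) * (1 / t - 1) \<le> 0"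
        using that x q by (intro mult_nonpos_nonneg) auto
      ultimately have "F' t \<le> 0" unfolding F'_def by (intro add_nonpos_nonpos) auto
      then show ?thesis using F_deriv[of t] that x by auto
    qed
    then show ?thesis using DERIV_nonpos_imp_nonincreasing[of x q F] False by simp
  qed
  then show ?thesis by (simp add: F_def algebra_simps)
qed

text \<open>The difference vanishes at 1 and has derivative \<open>ln t - (t - 1) \<le> 0\<close>
  for positive \<open>t\<close>. The endpoint 0, where differentiation fails, is treated
  apart.\<close>

lemma h_fun_ge_square:
  assumes "0 \<le> x" "x \<le> 1"
  shows "(1 - x)\<^sup>2 / 2 \<le> h_fun x"
proof (cases "x = 0")
  case False
  define F where "F = (\<lambda>t. h_fun t - (1 - t)\<^sup>2 / 2)"
  have "\<exists>y. (F has_real_derivative y) (at t) \<and> y \<le> 0" if "x \<le> t" "t \<le> 1" for t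
  proof -
    have "t > 0" using that False assms by simp
    then have "(F has_real_derivative ln t - (t - 1)) (at t)"
      unfolding F_def h_fun_def by (auto intro!: derivative_eq_intros simp: field_simps)
    moreover have "ln t - (t - 1) \<le> 0" using ln_le_minus_one[OF \<open>t > 0\<close>] by simp
    ultimately show ?thesis by blast
  qed
  from DERIV_nonpos_imp_nonincreasing[OF assms(2) this] show ?thesis
    by (simp add: F_def h_fun_def)
qed (simp add: h_fun_def)

lemma h_fun_le_square:
  assumes "0 < q"
  shows "h_fun q \<le> (1 - q)\<^sup>2"
proof -
  have "q * ln q \<le> q * (q - 1)"
    using ln_le_minus_one[OF assms] assms by (simp add: mult_left_mono)
  then show ?thesis by (simp add: h_fun_def power2_eq_square algebra_simps)
qed

text \<open>Extends the tangent bound to all of \<open>[0, 1]\<close>, with the penalty in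
  \<open>log_gain\<close> taking over below 1/2.\<close>

lemma h_fun_lower:
  fixes x q \<eta> :: real
  assumes \<eta>: "19/20 \<le> \<eta>" "\<eta> \<le> q" "q < 1" and x: "0 \<le> x" "x \<le> 1"
  shows "h_fun q + q * ln q * log_gain \<eta> q x + (x - q)\<^sup>2 / 20 \<le> h_fun x"
proof (cases "x < 1/2")
  case True
  have q0: "q > 0" using \<eta> by simp
  \<comment> \<open>Crude estimates suffice for \<open>x < 1/2\<close>: the left side is at most
    1/400 + 1/19 + 1/20, which is below 1/8. The threshold 19/20 supplies the first two
    terms.\<close>
  have "(1/2)\<^sup>2 \<le> (1 - x)\<^sup>2" using True by (intro power_mono) auto
  then have 1: "1/8 \<le> h_fun x"
    using h_fun_ge_square[OF x] by (simp add: power2_eq_square)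
  have "(1 - q)\<^sup>2 \<le> (1/20)\<^sup>2" using \<eta> by (intro power_mono) auto
  then have 2: "h_fun q \<le> 1/400"
    using h_fun_le_square[OF q0] by (simp add: power2_eq_square)
  have "(x - q)\<^sup>2 \<le> 1\<^sup>2" using x \<eta> by (intro power2_le_iff_abs_le[THEN iffD2]) auto
  then have 3: "(x - q)\<^sup>2 / 20 \<le> 1/20" by simp
  have "- ln q \<le> 1 / q - 1"
    using ln_le_minus_one[of "1 / q"] q0 by (simp add: ln_div)
  then have "- (q * ln q) \<le> 1 - q" using q0 by (simp add: field_simps)
  also have "\<dots> \<le> 1/20" using \<eta> by simp
  also have "1/20 \<le> 1/19 * \<eta>" using \<eta> by simp
  finally have 4: "- (q * ln q) / \<eta> \<le> 1/19" using \<eta> by (subst pos_divide_le_eq) auto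
  show ?thesis using 1 2 3 4 True by (simp add: log_gain_def)
next
  case False
  then show ?thesis
    using h_fun_lower_half[of q x] \<eta> x by (simp add: log_gain_def)
qed

text \<open>If all factors are at least 1/2, the product equals \<open>\<eta> * exp s\<close> with
  \<open>s\<close> the total gain, and \<open>exp s \<ge> 1 + s\<close>. A smaller factor makes the
  left side nonpositive.\<close>

lemma prod_ge_log_gain:
  fixes x :: "'b \<Rightarrow> real"
  assumes A: "finite A" "A \<noteq> {}" and \<eta>: "0 < q" "q \<le> 1" "q ^ card A = \<eta>"
    and x: "\<And>a. a \<in> A \<Longrightarrow> x a \<in> {0..1}"
  shows "\<eta> * (1 + (\<Sum>a\<in>A. log_gain \<eta> q (x a))) \<le> (\<Prod>a\<in>A. x a)"
proof -
  have \<eta>0: "0 < \<eta>" "\<eta> \<le> 1" using \<eta> by (auto simp: power_le_one)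
  have lnq: "real (card A) * ln q = ln \<eta>" using \<eta> by (auto simp: ln_realpow)
  show ?thesis
  proof (cases "\<exists>a\<in>A. x a < 1/2")
    case True
    then obtain a where a: "a \<in> A" "x a < 1/2" by blast
    have "log_gain \<eta> q (x b) \<le> - ln q" if "b \<in> A" for b
    proof -
      have "ln q \<le> 0" using \<eta> by simp
      then have "- (1 / \<eta>) \<le> - ln q" using \<eta>0 by (smt (verit) divide_nonneg_pos)
      then show ?thesis using x[OF that] by (auto simp: log_gain_def)
    qed
    \<comment> \<open>The small factor contributes \<open>- (1 / \<eta>)\<close>, and the others
      together at most \<open>- ln \<eta> \<le> 1 / \<eta> - 1\<close>, so the total gain is at most
      -1.\<close>
    then have "(\<Sum>b\<in>A - {a}. log_gain \<eta> q (x b)) \<le> real (card (A - {a})) * (- ln q)"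
      using sum_bounded_above[of "A - {a}" "\<lambda>b. log_gain \<eta> q (x b)" "- ln q"] by simp
    also have "\<dots> \<le> real (card A) * (- ln q)"
      using \<eta> A by (intro mult_right_mono) (auto simp: card_Diff1_le)
    also have "\<dots> \<le> 1 / \<eta> - 1"
      using ln_le_minus_one[of "1 / \<eta>"] \<eta>0 lnq by (simp add: ln_div)
    finally have "(\<Sum>b\<in>A. log_gain \<eta> q (x b)) \<le> - 1"
      using a A by (simp add: sum.remove[of A a] log_gain_def)
    then have "\<eta> * (1 + (\<Sum>b\<in>A. log_gain \<eta> q (x b))) \<le> 0"
      using \<eta>0 by (intro mult_nonneg_nonpos) auto
    also have "0 \<le> (\<Prod>b\<in>A. x b)" using x by (intro prod_nonneg) auto
    finally show ?thesis .
  next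
    case False
    then have pos: "x a > 0" if "a \<in> A" for a using that by force
    have "(\<Sum>a\<in>A. log_gain \<eta> q (x a)) = (\<Sum>a\<in>A. ln (x a) - ln q)"
      using False by (intro sum.cong) (auto simp: log_gain_def)
    also have "\<dots> = ln (\<Prod>a\<in>A. x a) - ln \<eta>"
      using lnq ln_prod[of A x] A pos by (force simp: sum_subtractf)
    finally have "\<eta> * exp (\<Sum>a\<in>A. log_gain \<eta> q (x a)) = (\<Prod>a\<in>A. x a)"
      using pos \<eta>0 by (simp add: exp_diff prod_pos)
    then show ?thesis
      using exp_ge_add_one_self[of "\<Sum>a\<in>A. log_gain \<eta> q (x a)"] \<eta>0
      by (metis mult_left_mono order_less_imp_le)
  qed
qed

section \<open>Copies in the complete graph\<close>

lemma finite_pairs [simp]: "finite (pairs n)"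
  by (simp add: pairs_def finite_imp_finite_nsets)

lemma card_pairs: "card (pairs n) = n choose 2"
  by (simp add: pairs_def)

definition copies :: "'a graph \<Rightarrow> nat \<Rightarrow> nat graph set" where
  "copies H n = {F. subgraph_of F (complete_simple_graph n) \<and> graph_isomorphic H F}"

lemma num_copies_complete: "num_copies H (complete_simple_graph n) = card (copies H n)"
  by (simp add: num_copies_def copies_def)

lemma copies_subset: "copies H n \<subseteq> Pow {1..n} \<times> Pow (pairs n)"
  by (auto simp: copies_def subgraph_of_def complete_simple_graph_def)

lemma finite_copies [simp]: "finite (copies H n)"
  using copies_subset by (rule finite_subset) auto

lemma copy_edges_subset: "F \<in> copies H n \<Longrightarrow> snd F \<subseteq> pairs n"
  using copies_subset by fastforce

text \<open>A random graph keeps all \<open>n\<close> vertices, so counting its copies amounts to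
  selecting from the fixed family \<open>copies H n\<close> by edges alone.\<close>

lemma num_copies_subgraph:
  assumes "E \<subseteq> pairs n"
  shows "num_copies H ({1..n}, E) = card {F \<in> copies H n. snd F \<subseteq> E}"
  unfolding num_copies_def copies_def subgraph_of_def complete_simple_graph_def
  using assms by (intro arg_cong[where f = card]) auto

lemma card_copy_edges:
  assumes "simple_graph H" "F \<in> copies H n"
  shows "card (snd F) = num_edges H"
proof -
  obtain f where f: "bij_betw f (fst H) (fst F)" "(`) f ` snd H = snd F"
    using assms(2) by (auto simp: copies_def graph_isomorphic_def)
  \<comment> \<open>Edges are sets of vertices, so injectivity of \<open>f\<close> on vertices
    passes to its action on edges.\<close>
  have "snd H \<subseteq> Pow (fst H)" using assms(1) by (auto simp: simple_graph_def nsets_def)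
  then have "inj_on ((`) f) (snd H)"
    using f(1) by (meson bij_betw_imp_inj_on inj_on_image_Pow inj_on_subset)
  then show ?thesis using f(2) card_image by (fastforce simp: num_edges_def)
qed

section \<open>Relabelling of graphs and the symmetry of the complete graph\<close>

definition map_graph :: "('a \<Rightarrow> 'b) \<Rightarrow> 'a graph \<Rightarrow> 'b graph" where
  "map_graph f G = (f ` fst G, (`) f ` snd G)"

lemma simple_graph_map:
  assumes "simple_graph G" "inj_on f (fst G)"
  shows "simple_graph (map_graph f G)"
proof -
  have "f ` e \<in> nsets (f ` fst G) 2" if "e \<in> nsets (fst G) 2" for e
    using that assms(2) by (auto simp: nsets_def card_image inj_on_subset)
  then show ?thesis using assms(1) by (auto simp: simple_graph_def map_graph_def)
qed

lemma graph_isomorphic_map: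
  assumes "inj_on f (fst G)"
  shows "graph_isomorphic G (map_graph f G)"
  using assms by (auto simp: graph_isomorphic_def map_graph_def bij_betw_def)

lemma graph_isomorphic_trans:
  assumes "graph_isomorphic G G'" "graph_isomorphic G' G''"
  shows "graph_isomorphic G G''"
proof -
  obtain f g where f: "bij_betw f (fst G) (fst G')" "(`) f ` snd G = snd G'"
    and g: "bij_betw g (fst G') (fst G'')" "(`) g ` snd G' = snd G''"
    using assms by (auto simp: graph_isomorphic_def)
  have "(`) (g \<circ> f) ` snd G = snd G''"
    unfolding f(2)[symmetric] g(2)[symmetric] by (simp add: image_image)
  then show ?thesis
    using bij_betw_trans[OF f(1) g(1)] unfolding graph_isomorphic_def by blast
qed

lemma map_graph_subgraph_complete:
  assumes "simple_graph G" "inj_on f (fst G)" "f ` fst G \<subseteq> {1..n}"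
  shows "subgraph_of (map_graph f G) (complete_simple_graph n)"
proof -
  have s: "simple_graph (map_graph f G)" using assms by (simp add: simple_graph_map)
  moreover have "snd (map_graph f G) \<subseteq> pairs n"
    using s assms(3) nsets_mono[OF assms(3), of 2]
    by (auto simp: simple_graph_def pairs_def map_graph_def)
  ultimately show ?thesis
    using assms(3) by (simp add: subgraph_of_def complete_simple_graph_def map_graph_def)
qed

lemma copies_nonempty:
  assumes "simple_graph H" "num_verts H \<le> n"
  shows "copies H n \<noteq> {}"
proof -
  obtain f where f: "f ` fst H \<subseteq> {1..n}" "inj_on f (fst H)"
    using card_le_inj[of "fst H" "{1..n}"] assms
    by (auto simp: simple_graph_def num_verts_def)
  then have "map_graph f H \<in> copies H n"
    using assms by (simp add: copies_def map_graph_subgraph_complete graph_isomorphic_map)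
  then show ?thesis by blast
qed

text \<open>Glue a bijection from \<open>e\<close> to \<open>e'\<close> with one between their
  complements, which have equal size: permutations act transitively on edges.\<close>

lemma ex_bij_pairs:
  assumes "e \<in> pairs n" "e' \<in> pairs n"
  obtains p where "bij_betw p {1..n} {1..n}" "p ` e = e'"
proof -
  have e: "e \<subseteq> {1..n}" "finite e" "card e = 2" and e': "e' \<subseteq> {1..n}" "finite e'" "card e' = 2"
    using assms by (auto simp: pairs_def nsets_def)
  obtain f where f: "bij_betw f e e'"
    using finite_same_card_bij[of e e'] e e' by auto
  have "card ({1..n} - e) = card ({1..n} - e')" using e e' by (simp add: card_Diff_subset)
  then obtain g where g: "bij_betw g ({1..n} - e) ({1..n} - e')"
    using finite_same_card_bij[of "{1..n} - e" "{1..n} - e'"] by auto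
  define p where "p = (\<lambda>x. if x \<in> e then f x else g x)"
  have pe: "bij_betw p e e'" using f by (rule bij_betw_cong[THEN iffD1, rotated]) (simp add: p_def)
  have pg: "bij_betw p ({1..n} - e) ({1..n} - e')"
    using g by (rule bij_betw_cong[THEN iffD1, rotated]) (simp add: p_def)
  have "bij_betw p (e \<union> ({1..n} - e)) (e' \<union> ({1..n} - e'))"
    by (rule bij_betw_combine[OF pe pg]) auto
  moreover have "e \<union> ({1..n} - e) = {1..n}" "e' \<union> ({1..n} - e') = {1..n}" using e e' by auto
  ultimately have "bij_betw p {1..n} {1..n}" by simp
  then show thesis using that pe by (auto simp: bij_betw_def)
qed

text \<open>Relabelling by a permutation that takes \<open>e\<close> to \<open>e'\<close> injects
  the copies through \<open>e\<close> into those through \<open>e'\<close>. Exchanging the edges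
  gives the reverse inequality.\<close>

lemma card_copies_edge_le:
  assumes "e \<in> pairs n" "e' \<in> pairs n"
  shows "card {F \<in> copies H n. e \<in> snd F} \<le> card {F \<in> copies H n. e' \<in> snd F}"
proof -
  obtain p where p: "bij_betw p {1..n} {1..n}" "p ` e = e'" using ex_bij_pairs[OF assms] .
  have inj: "inj_on p {1..n}" and im: "p ` {1..n} = {1..n}" using p by (auto simp: bij_betw_def)
  \<comment> \<open>\<open>map_graph p\<close> acts by images on vertex sets and by iterated images
    on edge sets; each action inherits injectivity from \<open>p\<close>.\<close>
  have inj1: "inj_on ((`) p) (Pow {1..n})" using inj by (rule inj_on_image_Pow)
  have inj2: "inj_on ((`) ((`) p)) (Pow (pairs n))"
    by (rule inj_on_image_Pow, rule inj_on_subset[OF inj1]) (auto simp: pairs_def nsets_def)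
  have "map_graph p = map_prod ((`) p) ((`) ((`) p))"
    by (simp add: fun_eq_iff map_graph_def map_prod_def split_def)
  then have "inj_on (map_graph p) (copies H n)"
    using inj_on_subset[OF map_prod_inj_on[OF inj1 inj2] copies_subset] by simp
  then have "inj_on (map_graph p) {F \<in> copies H n. e \<in> snd F}" by (rule inj_on_subset) auto
  moreover have "map_graph p F \<in> {F \<in> copies H n. e' \<in> snd F}"
    if "F \<in> {F \<in> copies H n. e \<in> snd F}" for F
  proof -
    have F: "F \<in> copies H n" "e \<in> snd F" using that by auto
    then have sub: "simple_graph F" "fst F \<subseteq> {1..n}" and iso: "graph_isomorphic H F"
      by (auto simp: copies_def subgraph_of_def complete_simple_graph_def)
    have injF: "inj_on p (fst F)" using inj sub(2) by (rule inj_on_subset)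
    have "p ` fst F \<subseteq> {1..n}" using sub(2) im by blast
    then have "map_graph p F \<in> copies H n"
      using map_graph_subgraph_complete[OF sub(1) injF]
        graph_isomorphic_trans[OF iso graph_isomorphic_map[OF injF]] by (simp add: copies_def)
    then show ?thesis using F(2) p(2) by (auto simp: map_graph_def)
  qed
  ultimately show ?thesis
    by (intro card_inj_on_le[where f = "map_graph p"]) auto
qed

lemma copies_edge_regular:
  obtains D where "\<And>e. e \<in> pairs n \<Longrightarrow> card {F \<in> copies H n. e \<in> snd F} = D"
proof (cases "pairs n = {}")
  case False
  then obtain e0 where "e0 \<in> pairs n" by blast
  then show ?thesis
    using that[of "card {F \<in> copies H n. e0 \<in> snd F}"] card_copies_edge_le[of _ n _ H]
    by (meson le_antisym)
qed (use that in auto)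

text \<open>Double counting: exchanging the sums weights each edge by the number of copies through
  it, which is the same for all edges. The factor \<open>D\<close> serves every \<open>g\<close> at
  once.\<close>

lemma sum_copies_edges:
  assumes "simple_graph H" "num_edges H \<ge> 1" "num_verts H \<le> n"
  obtains D :: real where "D > 0"
    "\<And>g :: nat set \<Rightarrow> real. (\<Sum>F\<in>copies H n. \<Sum>e\<in>snd F. g e) = D * (\<Sum>e\<in>pairs n. g e)"
proof -
  obtain d where d: "\<And>e. e \<in> pairs n \<Longrightarrow> card {F \<in> copies H n. e \<in> snd F} = d"
    using copies_edge_regular by blast
  have eq: "(\<Sum>F\<in>copies H n. \<Sum>e\<in>snd F. g e) = real d * (\<Sum>e\<in>pairs n. g e)"
    for g :: "nat set \<Rightarrow> real"
  proof -
    have "(\<Sum>F\<in>copies H n. \<Sum>e\<in>snd F. g e)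
        = (\<Sum>F\<in>copies H n. \<Sum>e\<in>{e \<in> pairs n. e \<in> snd F}. g e)"
      using copy_edges_subset[of _ H n]
      by (intro sum.cong[OF refl] arg_cong[where f = "sum g"]) blast
    also have "\<dots> = (\<Sum>e\<in>pairs n. \<Sum>F\<in>{F \<in> copies H n. e \<in> snd F}. g e)"
      by (rule sum.swap_restrict) auto
    also have "\<dots> = (\<Sum>e\<in>pairs n. real d * g e)" using d by (intro sum.cong) auto
    finally show ?thesis by (simp add: sum_distrib_left)
  qed
  \<comment> \<open>Taking \<open>g = 1\<close> counts incidences of edges and copies. The count is
    positive because there is a copy and it has an edge, hence \<open>d > 0\<close>.\<close>
  have "real d * real (card (pairs n)) = (\<Sum>F\<in>copies H n. real (card (snd F)))"
    using eq[of "\<lambda>_. 1"] by simp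
  also have "\<dots> = real (card (copies H n)) * real (num_edges H)"
    using card_copy_edges[OF assms(1)] by simp
  also have "\<dots> > 0" using copies_nonempty[OF assms(1,3)] assms(2) by (simp add: card_gt_0_iff)
  finally have "real d > 0" by (simp add: zero_less_mult_iff)
  then show thesis using that eq by blast
qed

section \<open>The expected number of copies as a polynomial in the edge probabilities\<close>

lemma expected_copies_eq:
  assumes "\<And>e. e \<in> pairs n \<Longrightarrow> q e \<in> {0..1}"
  shows "expected_copies H n q = (\<Sum>F\<in>copies H n. \<Prod>e\<in>snd F. q e)"
proof -
  let ?M = "Pi_pmf (pairs n) False (\<lambda>e. bernoulli_pmf (q e))"
  have count: "real (num_copies H ({1..n}, {e \<in> pairs n. b e}))
      = (\<Sum>F\<in>copies H n. indicator {b. \<forall>e\<in>snd F. b e} b)" for b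
  proof -
    have "num_copies H ({1..n}, {e \<in> pairs n. b e}) = card {F \<in> copies H n. \<forall>e\<in>snd F. b e}"
      using copy_edges_subset[of _ H n]
      by (subst num_copies_subgraph, blast, intro arg_cong[where f = card]) blast
    then show ?thesis by (simp add: indicator_def sum.If_cases Int_def)
  qed
  have prob: "measure_pmf.prob ?M {b. \<forall>e\<in>snd F. b e} = (\<Prod>e\<in>snd F. q e)"
    if F: "F \<in> copies H n" for F
  proof -
    \<comment> \<open>Written as a box whose coordinates off \<open>F\<close> are free, the event
      has a product probability by independence.\<close>
    define B where "B = (\<lambda>e. if e \<in> snd F then {True} else UNIV)"
    have "{b. \<forall>e\<in>snd F. b e} = Pi (pairs n) B"
      using copy_edges_subset[OF F] by (auto simp: B_def Pi_def)
    then have "measure_pmf.prob ?M {b. \<forall>e\<in>snd F. b e}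
        = (\<Prod>e\<in>pairs n. measure_pmf.prob (bernoulli_pmf (q e)) (B e))"
      by (simp add: measure_Pi_pmf_Pi)
    also have "\<dots> = (\<Prod>e\<in>pairs n. if e \<in> snd F then q e else 1)"
      using assms by (intro prod.cong) (auto simp: B_def measure_pmf_single)
    also have "\<dots> = (\<Prod>e\<in>snd F. q e)"
      using copy_edges_subset[OF F] by (simp add: prod.If_cases Int_absorb1)
    finally show ?thesis .
  qed
  have "expected_copies H n q
      = measure_pmf.expectation ?M (\<lambda>b. \<Sum>F\<in>copies H n. indicator {b. \<forall>e\<in>snd F. b e} b)"
    by (simp add: expected_copies_def random_graph_def flip: count)
  also have "\<dots> = (\<Sum>F\<in>copies H n. measure_pmf.prob ?M {b. \<forall>e\<in>snd F. b e})"
    by (subst Bochner_Integration.integral_sum) (auto intro!: measure_pmf.integrable_const_bound[where B=1])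
  also have "\<dots> = (\<Sum>F\<in>copies H n. \<Prod>e\<in>snd F. q e)" using prob by simp
  finally show ?thesis .
qed

section \<open>Stability\<close>

text \<open>The last fact lets a lower bound on \<open>\<eta>\<close> serve for \<open>q\<close> as
  well, as \<open>h_fun_lower\<close> requires.\<close>

lemma powr_inverse_nat:
  fixes \<eta> :: real
  assumes "0 < \<eta>" "\<eta> < 1" "m \<ge> 1"
  shows "(\<eta> powr (1 / real m)) ^ m = \<eta>" "0 < \<eta> powr (1 / real m)"
    "\<eta> powr (1 / real m) < 1" "\<eta> \<le> \<eta> powr (1 / real m)"
proof -
  show 1: "(\<eta> powr (1 / real m)) ^ m = \<eta>" using assms by (simp add: powr_realpow[symmetric] powr_powr)
  show 0: "0 < \<eta> powr (1 / real m)" using assms by simp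
  show 2: "\<eta> powr (1 / real m) < 1" 
    using one_le_power[of "\<eta> powr (1 / real m)" m] 1 assms by linarith
  show "\<eta> \<le> \<eta> powr (1 / real m)"
    using power_decreasing[of 1 m "\<eta> powr (1 / real m)"] 0 1 2 assms(3) by simp
qed

text \<open>The quadratic excess over the cost of the constant vector yields both uniqueness and
  stability.\<close>

lemma cost_lower:
  assumes H: "simple_graph H" "num_edges H \<ge> 1" "num_verts H \<le> n"
    and \<eta>: "19/20 \<le> \<eta>" "\<eta> < 1" and q: "q = \<eta> powr (1 / real (num_edges H))"
    and feas: "feasible H \<eta> n qv"
  shows "real (card (pairs n)) * h_fun q + (\<Sum>e\<in>pairs n. (qv e - q)\<^sup>2) / 20 \<le> cost n qv"
proof -
  have qpow: "q ^ num_edges H = \<eta>" and q0: "0 < q" "q < 1" and "\<eta> \<le> q"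
    using powr_inverse_nat[of \<eta> "num_edges H"] \<eta> H(2) by (auto simp: q)
  have qv: "qv e \<in> {0..1}" if "e \<in> pairs n" for e
    using feas that by (auto simp: feasible_def edge_cube_def PiE_iff)
  obtain D where "D > 0" and
    D: "\<And>g :: nat set \<Rightarrow> real. (\<Sum>F\<in>copies H n. \<Sum>e\<in>snd F. g e) = D * (\<Sum>e\<in>pairs n. g e)"
    using sum_copies_edges[OF H] by blast
  \<comment> \<open>Summing the linear lower bound over all copies turns the constraint into one on
    the total gain over all edges.\<close>
  have "\<eta> * real (card (copies H n)) + \<eta> * D * (\<Sum>e\<in>pairs n. log_gain \<eta> q (qv e))
      = (\<Sum>F\<in>copies H n. \<eta> * (1 + (\<Sum>e\<in>snd F. log_gain \<eta> q (qv e))))"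
    by (simp add: D sum.distrib flip: sum_distrib_left) (simp add: algebra_simps)
  also have "\<dots> \<le> (\<Sum>F\<in>copies H n. \<Prod>e\<in>snd F. qv e)"
  proof (rule sum_mono)
    fix F assume F: "F \<in> copies H n"
    have c: "card (snd F) = num_edges H" using card_copy_edges[OF H(1) F] .
    then have "finite (snd F)" "snd F \<noteq> {}" using H(2) card_gt_0_iff[of "snd F"] by auto
    then show "\<eta> * (1 + (\<Sum>e\<in>snd F. log_gain \<eta> q (qv e))) \<le> (\<Prod>e\<in>snd F. qv e)"
      using c q0 qpow qv copy_edges_subset[OF F] by (intro prod_ge_log_gain) auto
  qed
  also have "\<dots> = expected_copies H n qv" using qv by (simp add: expected_copies_eq)
  also have "\<dots> \<le> \<eta> * real (card (copies H n))"
    using feas by (simp add: feasible_def num_copies_complete)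
  finally have "(\<Sum>e\<in>pairs n. log_gain \<eta> q (qv e)) \<le> 0"
    using \<eta> \<open>D > 0\<close> by (simp add: mult_le_0_iff)
  then have "0 \<le> q * ln q * (\<Sum>e\<in>pairs n. log_gain \<eta> q (qv e))"
    using q0 by (simp add: mult_nonpos_nonpos mult_nonneg_nonpos)
  moreover have "(\<Sum>e\<in>pairs n. h_fun q + q * ln q * log_gain \<eta> q (qv e) + (qv e - q)\<^sup>2 / 20)
      \<le> cost n qv"
    unfolding cost_def using qv \<eta> q0 \<open>\<eta> \<le> q\<close> by (intro sum_mono h_fun_lower) auto
  ultimately show ?thesis
    by (simp add: sum.distrib sum_distrib_left sum_divide_distrib)
qed

lemma cost_const_vec: "cost n (const_vec n c) = real (card (pairs n)) * h_fun c"
  by (simp add: cost_def const_vec_def)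

text \<open>Each copy has exactly \<open>num_edges H\<close> edges, so every product equals
  \<open>\<eta>\<close> and the constraint is tight.\<close>

lemma feasible_const_vec:
  assumes "simple_graph H" "0 \<le> c" "c \<le> 1" "c ^ num_edges H = \<eta>"
  shows "feasible H \<eta> n (const_vec n c)"
proof -
  have "(\<Prod>e\<in>snd F. const_vec n c e) = \<eta>" if "F \<in> copies H n" for F
  proof -
    have "(\<Prod>e\<in>snd F. const_vec n c e) = (\<Prod>e\<in>snd F. c)"
      using copy_edges_subset[OF that] by (intro prod.cong) (auto simp: const_vec_def)
    then show ?thesis using assms card_copy_edges[OF assms(1) that] by simp
  qed
  then have "expected_copies H n (const_vec n c) = \<eta> * real (card (copies H n))"
    using assms by (subst expected_copies_eq) (auto simp: const_vec_def)
  then show ?thesis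
    using assms by (auto simp: feasible_def num_copies_complete edge_cube_def const_vec_def)
qed

section \<open>Bounding the cut norm by the sum of squares of the entries\<close>

lemma sum_abs_sym_matrix:
  "(\<Sum>i\<in>{1..n}. \<Sum>j\<in>{1..n}. \<bar>sym_matrix v i j\<bar>) = 2 * (\<Sum>e\<in>pairs n. \<bar>v e\<bar>)"
proof -
  let ?S = "{p \<in> {1..n} \<times> {1..n}. fst p \<noteq> snd p}"
  let ?g = "\<lambda>p. {fst p, snd p}"
  have "(\<Sum>i\<in>{1..n}. \<Sum>j\<in>{1..n}. \<bar>sym_matrix v i j\<bar>)
      = (\<Sum>p\<in>{1..n} \<times> {1..n}. \<bar>sym_matrix v (fst p) (snd p)\<bar>)"
    by (simp add: sum.cartesian_product split_def)
  also have "\<dots> = (\<Sum>p\<in>?S. \<bar>v (?g p)\<bar>)"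
    by (intro sum.mono_neutral_cong_right) (auto simp: sym_matrix_def)
  also have "\<dots> = (\<Sum>e\<in>pairs n. \<Sum>p\<in>{p \<in> ?S. ?g p = e}. \<bar>v (?g p)\<bar>)"
    by (rule sum.group[symmetric]) (auto simp: pairs_def finite_imp_finite_nsets)
  also have "\<dots> = (\<Sum>e\<in>pairs n. 2 * \<bar>v e\<bar>)"
  proof (rule sum.cong[OF refl])
    fix e assume "e \<in> pairs n"
    then obtain a b where ab: "e = {a, b}" "a \<in> {1..n}" "b \<in> {1..n}" "a \<noteq> b"
      unfolding pairs_def by (rule nsets2_E)
    \<comment> \<open>An edge arises from exactly two ordered pairs, whence the factor 2.\<close>
    then have "{p \<in> ?S. ?g p = e} = {(a, b), (b, a)}" by (auto simp: doubleton_eq_iff)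
    then show "(\<Sum>p\<in>{p \<in> ?S. ?g p = e}. \<bar>v (?g p)\<bar>) = 2 * \<bar>v e\<bar>"
      using ab by (simp add: insert_commute)
  qed
  finally show ?thesis by (simp add: sum_distrib_left)
qed

text \<open>Test vectors have entries in \<open>[0, 1]\<close>, so the bilinear form is at most the
  sum of the absolute values of the matrix entries.\<close>

lemma cut_norm_vec_le: "cut_norm_vec n v \<le> 2 / real n ^ 2 * (\<Sum>e\<in>pairs n. \<bar>v e\<bar>)"
proof -
  let ?A = "sym_matrix v"
  have "1 / real n ^ 2 * \<bar>\<Sum>i\<in>{1..n}. \<Sum>j\<in>{1..n}. x i * ?A i j * y j\<bar>
      \<le> 2 / real n ^ 2 * (\<Sum>e\<in>pairs n. \<bar>v e\<bar>)"
    if xy: "x \<in> {1..n} \<rightarrow>\<^sub>E {0..1}" "y \<in> {1..n} \<rightarrow>\<^sub>E {0..1}" for x y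
  proof -
    have "\<bar>\<Sum>i\<in>{1..n}. \<Sum>j\<in>{1..n}. x i * ?A i j * y j\<bar>
        \<le> (\<Sum>i\<in>{1..n}. \<Sum>j\<in>{1..n}. \<bar>x i * ?A i j * y j\<bar>)"
      by (rule order_trans[OF sum_abs sum_mono[OF sum_abs]])
    also have "\<dots> \<le> (\<Sum>i\<in>{1..n}. \<Sum>j\<in>{1..n}. \<bar>?A i j\<bar>)"
    proof (intro sum_mono)
      fix i j assume "i \<in> {1..n}" "j \<in> {1..n}"
      then have "x i \<in> {0..1}" "y j \<in> {0..1}" using xy by (auto simp: PiE_iff)
      then have "x i * y j * \<bar>?A i j\<bar> \<le> 1 * \<bar>?A i j\<bar>"
        by (intro mult_right_mono mult_le_one) auto
      then show "\<bar>x i * ?A i j * y j\<bar> \<le> \<bar>?A i j\<bar>"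
        using \<open>x i \<in> {0..1}\<close> \<open>y j \<in> {0..1}\<close> by (simp add: abs_mult mult_ac)
    qed
    finally show ?thesis
      by (simp add: sum_abs_sym_matrix[simplified] divide_right_mono)
  qed
  \<comment> \<open>A witness that the supremum ranges over a nonempty set.\<close>
  moreover have "(\<lambda>i\<in>{1..n}. 0 :: real) \<in> {1..n} \<rightarrow>\<^sub>E {0..1}" by auto
  ultimately show ?thesis
    unfolding cut_norm_vec_def cut_norm_def by (intro cSUP_least) (auto simp: PiE_eq_empty_iff)
qed

text \<open>AM-GM at the scale \<open>s\<close> plays the part of Cauchy-Schwarz and avoids square
  roots.\<close>

lemma cut_norm_vec_le_of_square_sum:
  assumes "s > 0" and sq: "(\<Sum>e\<in>pairs n. (v e)\<^sup>2) \<le> c * s\<^sup>2 * real (card (pairs n))"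
    and "c \<ge> 0"
  shows "cut_norm_vec n v \<le> (1 + c) / 2 * s"
proof -
  let ?N = "real (card (pairs n))"
  have AMGM: "\<bar>a\<bar> \<le> (s + a\<^sup>2 / s) / 2" for a :: real
  proof -
    have "0 \<le> (s - \<bar>a\<bar>)\<^sup>2 / s" using assms by simp
    then show ?thesis using assms by (simp add: field_simps power2_eq_square)
  qed
  have "(\<Sum>e\<in>pairs n. \<bar>v e\<bar>) \<le> (\<Sum>e\<in>pairs n. (s + (v e)\<^sup>2 / s) / 2)"
    by (intro sum_mono AMGM)
  also have "\<dots> = (?N * s + (\<Sum>e\<in>pairs n. (v e)\<^sup>2) / s) / 2"
    by (simp add: sum.distrib flip: sum_divide_distrib)
  also have "\<dots> \<le> (?N * s + c * s\<^sup>2 * ?N / s) / 2"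
    using sq assms by (intro divide_right_mono add_left_mono) auto
  also have "\<dots> = (1 + c) / 2 * s * ?N"
    using assms by (simp add: field_simps power2_eq_square)
  finally have 1: "(\<Sum>e\<in>pairs n. \<bar>v e\<bar>) \<le> (1 + c) / 2 * s * ?N" .
  have "2 * (n choose 2) \<le> n * (n - 1)" by (simp add: choose_two)
  also have "\<dots> \<le> n ^ 2" by (simp add: power2_eq_square)
  finally have "2 * ?N \<le> real n ^ 2"
    unfolding card_pairs by (metis of_nat_le_iff of_nat_mult of_nat_numeral of_nat_power)
  \<comment> \<open>For \<open>n = 0\<close> the quotient is 0 by the convention on
    division.\<close>
  then have N: "2 / real n ^ 2 * ?N \<le> 1" by (auto simp: divide_le_eq_1)
  have "cut_norm_vec n v \<le> 2 / real n ^ 2 * ((1 + c) / 2 * s * ?N)"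
    using 1 by (intro order_trans[OF cut_norm_vec_le] mult_left_mono) auto
  also have "\<dots> = (1 + c) / 2 * s * (2 / real n ^ 2 * ?N)" by simp
  also have "\<dots> \<le> (1 + c) / 2 * s * 1" using N assms by (intro mult_left_mono) auto
  finally show ?thesis by simp
qed

theorem proposition4p2:
  fixes H :: "'a graph"
  assumes "simple_graph H" and "num_edges H \<ge> 1"
  shows "\<exists>\<eta>\<^sub>H<1. \<forall>\<eta>. \<eta>\<^sub>H < \<eta> \<and> \<eta> < 1 \<longrightarrow>
    (\<exists>C :: real. \<exists>\<epsilon>\<^sub>0>0. \<forall>\<epsilon> n. 0 < \<epsilon> \<and> \<epsilon> < \<epsilon>\<^sub>0 \<and> num_verts H \<le> n \<longrightarrow>
      (let q = \<eta> powr (1 / real (num_edges H)) in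
        unique_minimizer H \<eta> n (const_vec n q) \<and>
        (\<forall>qv \<in> edge_cube n.
           expected_copies H n qv \<le> \<eta> * real (num_copies H (complete_simple_graph n)) \<and>
           cost n qv < Phi H \<eta> n + \<epsilon> ^ 12 * real (n choose 2) \<longrightarrow>
           cut_norm_vec n (\<lambda>e. qv e - q) < C * \<epsilon>)))"
proof (rule exI[of _ "19/20"], intro conjI allI impI)
  fix \<eta> :: real
  assume "19/20 < \<eta> \<and> \<eta> < 1"
  then have \<eta>: "19/20 \<le> \<eta>" "\<eta> < 1" by auto
  define q where "q = \<eta> powr (1 / real (num_edges H))"
  have q: "q ^ num_edges H = \<eta>" "0 < q" "q < 1"
    using powr_inverse_nat[of \<eta> "num_edges H"] \<eta> assms(2) by (auto simp: q_def)
  \<comment> \<open>The constant 11 exceeds the factor (1 + 20) / 2 obtained below, which makes the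
    final inequality strict.\<close>
  have "unique_minimizer H \<eta> n (const_vec n q) \<and>
        (\<forall>qv \<in> edge_cube n.
           expected_copies H n qv \<le> \<eta> * real (num_copies H (complete_simple_graph n)) \<and>
           cost n qv < Phi H \<eta> n + \<epsilon> ^ 12 * real (n choose 2) \<longrightarrow>
           cut_norm_vec n (\<lambda>e. qv e - q) < 11 * \<epsilon>)"
    if \<epsilon>: "0 < \<epsilon>" "\<epsilon> < 1" and n: "num_verts H \<le> n" for \<epsilon> n
  proof -
    let ?c = "const_vec n q"
    have feas: "feasible H \<eta> n ?c" using feasible_const_vec[OF assms(1)] q by simp
    have lower: "cost n ?c + (\<Sum>e\<in>pairs n. (qv e - q)\<^sup>2) / 20 \<le> cost n qv"
      if "feasible H \<eta> n qv" for qv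
      using cost_lower[OF assms n \<eta> q_def that] by (simp add: cost_const_vec)
    have min: "cost n ?c \<le> cost n qv" if "feasible H \<eta> n qv" for qv
    proof -
      have "0 \<le> (\<Sum>e\<in>pairs n. (qv e - q)\<^sup>2)" by (intro sum_nonneg) auto
      then show ?thesis using lower[OF that] by simp
    qed
    have uniq: "qv = ?c" if qv: "feasible H \<eta> n qv" "cost n qv \<le> cost n ?c" for qv
    proof -
      have "(\<Sum>e\<in>pairs n. (qv e - q)\<^sup>2) \<le> 0" using lower[OF qv(1)] qv(2) by simp
      then have "(\<Sum>e\<in>pairs n. (qv e - q)\<^sup>2) = 0" by (intro antisym sum_nonneg) auto
      then have "\<forall>e\<in>pairs n. qv e = q" by (simp add: sum_nonneg_eq_0_iff)
      \<comment> \<open>Equality of functions also concerns arguments outside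
        \<open>pairs n\<close>, where both vectors are \<open>undefined\<close>.\<close>
      moreover have "qv \<in> extensional (pairs n)"
        using qv(1) by (auto simp: feasible_def edge_cube_def PiE_iff)
      ultimately show ?thesis by (auto simp: const_vec_def fun_eq_iff extensional_def)
    qed
    have "unique_minimizer H \<eta> n ?c"
      unfolding unique_minimizer_def is_arg_min_def using feas min uniq
      by (meson leD leI)
    moreover have "cut_norm_vec n (\<lambda>e. qv e - q) < 11 * \<epsilon>"
      if qv: "feasible H \<eta> n qv" "cost n qv < Phi H \<eta> n + \<epsilon> ^ 12 * real (n choose 2)" for qv
    proof -
      have "Phi H \<eta> n = cost n ?c"
        unfolding Phi_def using feas min by (intro cInf_eq_minimum) auto
      \<comment> \<open>The factor 20 inverts the 1/20 in \<open>lower\<close>, and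
        \<open>\<epsilon> ^ 12\<close> is the square of the scale \<open>\<epsilon> ^ 6\<close> used
        next.\<close>
      then have "(\<Sum>e\<in>pairs n. (qv e - q)\<^sup>2) \<le> 20 * (\<epsilon> ^ 6)\<^sup>2 * real (card (pairs n))"
        using lower[OF qv(1)] qv(2) by (simp add: card_pairs flip: power_mult)
      then have "cut_norm_vec n (\<lambda>e. qv e - q) \<le> (1 + 20) / 2 * \<epsilon> ^ 6"
        using \<epsilon> by (intro cut_norm_vec_le_of_square_sum) auto
      also have "\<dots> < 11 * \<epsilon> ^ 6" using \<epsilon> by simp
      \<comment> \<open>The deviation is of order \<open>\<epsilon> ^ 6\<close>;
        \<open>\<epsilon> < 1\<close> weakens this to order \<open>\<epsilon>\<close>.\<close>
      also have "\<dots> \<le> 11 * \<epsilon> ^ 1" using \<epsilon> by (intro mult_left_mono power_decreasing) auto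
      finally show ?thesis by simp
    qed
    ultimately show ?thesis by (auto simp: feasible_def)
  qed
  then show "\<exists>C :: real. \<exists>\<epsilon>\<^sub>0>0. \<forall>\<epsilon> n. 0 < \<epsilon> \<and> \<epsilon> < \<epsilon>\<^sub>0 \<and> num_verts H \<le> n \<longrightarrow>
      (let q = \<eta> powr (1 / real (num_edges H)) in
        unique_minimizer H \<eta> n (const_vec n q) \<and>
        (\<forall>qv \<in> edge_cube n.
           expected_copies H n qv \<le> \<eta> * real (num_copies H (complete_simple_graph n)) \<and>
           cost n qv < Phi H \<eta> n + \<epsilon> ^ 12 * real (n choose 2) \<longrightarrow>
           cut_norm_vec n (\<lambda>e. qv e - q) < C * \<epsilon>))"
    unfolding Let_def q_def by (intro exI[of _ 11] exI[of _ 1]) auto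
qed auto

end
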